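(* Let $m,n\in\mathbb{N}$ and let $L$ be any one of the logics $\mathbf{NA}_{m,n}$, $\mathbf{N}^+\mathbf{A}_{m,n}$, $\mathbf{NRA}_{m,n}$. Then $L$ enjoys the Lyndon interpolation property (LIP) and, consequently, enjoys the Craig interpolation property (CIP).
   Context: $\mathbb{N}$ includes $0$. Fix a countably infinite set $\mathrm{PropVar}$ of propositional variables. $\mathscr{L}_\Box$ is the set of formulas built from $\mathrm{PropVar}$ with $\land,\lor,\to,\bot,\Box$; $\top:=\bot\to\bot$, $\neg\varphi:=\varphi\to\bot$; $\Box^0\varphi:=\varphi$, $\Box^{k+1}\varphi:=\Box\Box^k\varphi$. Logics. $\mathbf{N}$ is classical propositional logic (tautologies in the language $\mathscr{L}_\Box$, modus ponens) plus the rule Nec: from $\varphi$ infer $\Box\varphi$. $\mathbf{NA}_{m,n}$ is $\mathbf{N}$ plus the axiom schema $\Box^n\varphi\to\Box^m\varphi$. $\mathbf{N}^+\mathbf{A}_{m,n}$ is $\mathbf{NA}_{m,n}$ plus the rule: from $\neg\Box\varphi$ infer $\neg\Box\Box\varphi$. $\mathbf{NRA}_{m,n}$ is $\mathbf{NA}_{m,n}$ plus the rule: from $\neg\varphi$ infer $\neg\Box\varphi$. (Rules apply to theorems; $L\vdash\varphi$ means $\varphi$ is a theorem of $L$.) Positive and negative variables. $\mathrm{V}^+(p)=\{p\}$, $\mathrm{V}^-(p)=\mathrm{V}^+(\bot)=\mathrm{V}^-(\bot)=\emptyset$; $\mathrm{V}^\bullet(\psi_1\to\psi_2)=\mathrm{V}^\circ(\psi_1)\cup\mathrm{V}^\bullet(\psi_2)$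 for $(\bullet,\circ)\in\{(+,-),(-,+)\}$; $\mathrm{V}^\bullet(\psi_1\land\psi_2)=\mathrm{V}^\bullet(\psi_1\lor\psi_2)=\mathrm{V}^\bullet(\psi_1)\cup\mathrm{V}^\bullet(\psi_2)$; $\mathrm{V}^\bullet(\Box\psi)=\mathrm{V}^\bullet(\psi)$. $\mathrm{V}(\varphi)=\mathrm{V}^+(\varphi)\cup\mathrm{V}^-(\varphi)$. LIP. $L$ enjoys LIP if for all $\varphi,\psi\in\mathscr{L}_\Box$ with $L\vdash\varphi\to\psi$ there is $\chi\in\mathscr{L}_\Box$ such that $\mathrm{V}^\bullet(\chi)\subseteq\mathrm{V}^\bullet(\varphi)\cap\mathrm{V}^\bullet(\psi)$ for each $\bullet\in\{+,-\}$, $L\vdash\varphi\to\chi$ and $L\vdash\chi\to\psi$. CIP is the same with the variable condition replaced by $\mathrm{V}(\chi)\subseteq\mathrm{V}(\varphi)\cap\mathrm{V}(\psi)$. *)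

theory Defs
  imports Main
begin

text \<open>Propositional variables: the countably infinite set is taken to be the type of naturals.\<close>

type_synonym propvar = nat

datatype fm =
    Var propvar
  | Falsum (\<open>\<^bold>\<bottom>\<close>)
  | And fm fm (infixr \<open>\<^bold>\<and>\<close> 65)
  | Or fm fm (infixr \<open>\<^bold>\<or>\<close> 60)
  | Imp fm fm (infixr \<open>\<^bold>\<rightarrow>\<close> 55)
  | Box fm (\<open>\<^bold>\<box> _\<close> [80] 80)

abbreviation Neg :: "fm \<Rightarrow> fm" (\<open>\<^bold>\<not> _\<close> [80] 80)
  where "\<^bold>\<not> \<phi> \<equiv> \<phi> \<^bold>\<rightarrow> \<^bold>\<bottom>"

abbreviation Boxes :: "nat \<Rightarrow> fm \<Rightarrow> fm"
  where "Boxes k \<phi> \<equiv> (Box ^^ k) \<phi>"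

text \<open>
  Tautologies of classical propositional logic in the modal language. Boxed formulas are
  treated as additional atoms, whose truth values \<open>b\<close> are independent of everything else;
  so the tautologies are exactly the modal substitution instances of ordinary tautologies.
\<close>

primrec eval :: "(propvar \<Rightarrow> bool) \<Rightarrow> (fm \<Rightarrow> bool) \<Rightarrow> fm \<Rightarrow> bool" where
  "eval v b (Var p) = v p"
| "eval v b \<^bold>\<bottom> = False"
| "eval v b (\<phi> \<^bold>\<and> \<psi>) = (eval v b \<phi> \<and> eval v b \<psi>)"
| "eval v b (\<phi> \<^bold>\<or> \<psi>) = (eval v b \<phi> \<or> eval v b \<psi>)"
| "eval v b (\<phi> \<^bold>\<rightarrow> \<psi>) = (eval v b \<phi> \<longrightarrow> eval v b \<psi>)"
| "eval v b (\<^bold>\<box> \<phi>) = b \<phi>"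

definition tautology :: "fm \<Rightarrow> bool"
  where "tautology \<phi> \<longleftrightarrow> (\<forall>v b. eval v b \<phi>)"

text \<open>
  The set of theorems of the logic \<open>\<^bold>N\<close> extended by the axioms in \<open>Ax\<close> and by the one-premise
  rules in \<open>R\<close>, where \<open>(\<phi>, \<psi>) \<in> R\<close> stands for ``from \<open>\<phi>\<close> infer \<open>\<psi>\<close>''.
\<close>

inductive_set N_ext :: "fm set \<Rightarrow> (fm \<times> fm) set \<Rightarrow> fm set"
  for Ax :: "fm set" and R :: "(fm \<times> fm) set" where
  Taut: "tautology \<phi> \<Longrightarrow> \<phi> \<in> N_ext Ax R"
| Axiom: "\<phi> \<in> Ax \<Longrightarrow> \<phi> \<in> N_ext Ax R"
| MP: "\<phi> \<in> N_ext Ax R \<Longrightarrow> \<phi> \<^bold>\<rightarrow> \<psi> \<in> N_ext Ax R \<Longrightarrow> \<psi> \<in> N_ext Ax R"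
| Nec: "\<phi> \<in> N_ext Ax R \<Longrightarrow> \<^bold>\<box> \<phi> \<in> N_ext Ax R"
| Rule: "\<phi> \<in> N_ext Ax R \<Longrightarrow> (\<phi>, \<psi>) \<in> R \<Longrightarrow> \<psi> \<in> N_ext Ax R"

definition Acc :: "nat \<Rightarrow> nat \<Rightarrow> fm set"
  where "Acc m n = {Boxes n \<phi> \<^bold>\<rightarrow> Boxes m \<phi> | \<phi>. True}"

definition NA :: "nat \<Rightarrow> nat \<Rightarrow> fm set"
  where "NA m n = N_ext (Acc m n) {}"

definition NplusA :: "nat \<Rightarrow> nat \<Rightarrow> fm set"
  where "NplusA m n = N_ext (Acc m n) {(\<^bold>\<not> \<^bold>\<box> \<phi>, \<^bold>\<not> \<^bold>\<box> \<^bold>\<box> \<phi>) | \<phi>. True}"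

definition NRA :: "nat \<Rightarrow> nat \<Rightarrow> fm set"
  where "NRA m n = N_ext (Acc m n) {(\<^bold>\<not> \<phi>, \<^bold>\<not> \<^bold>\<box> \<phi>) | \<phi>. True}"

datatype sign = Plus | Minus

primrec opposite :: "sign \<Rightarrow> sign" where
  "opposite Plus = Minus"
| "opposite Minus = Plus"

primrec signed_vars :: "fm \<Rightarrow> sign \<Rightarrow> propvar set" where
  "signed_vars (Var p) s = (case s of Plus \<Rightarrow> {p} | Minus \<Rightarrow> {})"
| "signed_vars \<^bold>\<bottom> s = {}"
| "signed_vars (\<phi> \<^bold>\<and> \<psi>) s = signed_vars \<phi> s \<union> signed_vars \<psi> s"
| "signed_vars (\<phi> \<^bold>\<or> \<psi>) s = signed_vars \<phi> s \<union> signed_vars \<psi> s"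
| "signed_vars (\<phi> \<^bold>\<rightarrow> \<psi>) s = signed_vars \<phi> (opposite s) \<union> signed_vars \<psi> s"
| "signed_vars (\<^bold>\<box> \<phi>) s = signed_vars \<phi> s"

definition vars :: "fm \<Rightarrow> propvar set"
  where "vars \<phi> = signed_vars \<phi> Plus \<union> signed_vars \<phi> Minus"

text \<open>Interpolation properties of a logic, given as its set of theorems.\<close>

definition LIP :: "fm set \<Rightarrow> bool" where
  "LIP L \<longleftrightarrow> (\<forall>\<phi> \<psi>. \<phi> \<^bold>\<rightarrow> \<psi> \<in> L \<longrightarrow>
     (\<exists>\<chi>. (\<forall>s. signed_vars \<chi> s \<subseteq> signed_vars \<phi> s \<inter> signed_vars \<psi> s) \<and>
          \<phi> \<^bold>\<rightarrow> \<chi> \<in> L \<and> \<chi> \<^bold>\<rightarrow> \<psi> \<in> L))"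

definition CIP :: "fm set \<Rightarrow> bool" where
  "CIP L \<longleftrightarrow> (\<forall>\<phi> \<psi>. \<phi> \<^bold>\<rightarrow> \<psi> \<in> L \<longrightarrow>
     (\<exists>\<chi>. vars \<chi> \<subseteq> vars \<phi> \<inter> vars \<psi> \<and>
          \<phi> \<^bold>\<rightarrow> \<chi> \<in> L \<and> \<chi> \<^bold>\<rightarrow> \<psi> \<in> L))"

end

theory Submission
  imports Defs
begin

text \<open>
  If \<open>\<phi> \<rightarrow> \<psi>\<close> had no interpolant, there would be valuations \<open>w \<Turnstile> \<phi>\<close> and \<open>w' \<Turnstile> \<not>\<psi>\<close> of the logic such
  that \<open>w\<close> implies \<open>w'\<close> on all formulas over the common signed variables. They are merged into one
  valuation lying above \<open>w\<close> on the signed language of \<open>\<phi>\<close> and below \<open>w'\<close> on that of \<open>\<psi>\<close>, which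
  refutes \<open>\<phi> \<rightarrow> \<psi>\<close>. The formulas \<open>\<box>\<^sup>k\<rho>\<close>, for \<open>k\<close> ranging over the naturals, have the same signed
  variables, hence the same bounds, so the merged valuation can be chosen along each such chain
  to be constant or to be the pointwise conjunction or disjunction of \<open>w\<close> and/or \<open>w'\<close>. Each of these
  choices respects Nec, every axiom \<open>\<box>\<^sup>n\<rho> \<rightarrow> \<box>\<^sup>m\<rho>\<close> and every rule \<open>\<not>\<box>\<^sup>i\<rho> / \<not>\<box>\<^sup>j\<rho>\<close>.
\<close>

section \<open>Theories and valuations\<close>

definition valuation :: "(fm \<Rightarrow> bool) \<Rightarrow> bool"
  where "valuation w \<longleftrightarrow> (\<exists>v b. w = eval v b)"

lemma valuationI: "(\<And>\<phi>. eval v b \<phi> = w \<phi>) \<Longrightarrow> valuation w"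
  unfolding valuation_def by (intro exI[of _ v] exI[of _ b] ext) simp

lemma valuation_simps:
  assumes "valuation w"
  shows "\<not> w \<^bold>\<bottom>" "w (\<alpha> \<^bold>\<and> \<beta>) \<longleftrightarrow> w \<alpha> \<and> w \<beta>" "w (\<alpha> \<^bold>\<or> \<beta>) \<longleftrightarrow> w \<alpha> \<or> w \<beta>"
    "w (\<alpha> \<^bold>\<rightarrow> \<beta>) \<longleftrightarrow> (w \<alpha> \<longrightarrow> w \<beta>)"
  using assms by (auto simp: valuation_def)

text \<open>Closed under modus ponens but not under Nec: the theories built below contain local
  assumptions, whose boxes need not follow.\<close>

definition closed_theory :: "fm set \<Rightarrow> bool" where
  "closed_theory T \<longleftrightarrow> (\<forall>\<alpha>. tautology \<alpha> \<longrightarrow> \<alpha> \<in> T) \<and> (\<forall>\<alpha> \<beta>. \<alpha> \<in> T \<longrightarrow> \<alpha> \<^bold>\<rightarrow> \<beta> \<in> T \<longrightarrow> \<beta> \<in> T)"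

lemma closed_theory_taut: "closed_theory T \<Longrightarrow> tautology \<alpha> \<Longrightarrow> \<alpha> \<in> T"
  unfolding closed_theory_def by blast

lemma closed_theory_mp: "closed_theory T \<Longrightarrow> \<alpha> \<^bold>\<rightarrow> \<beta> \<in> T \<Longrightarrow> \<alpha> \<in> T \<Longrightarrow> \<beta> \<in> T"
  unfolding closed_theory_def by blast

lemma closed_theory_taut1:
  assumes "closed_theory T" "\<alpha> \<in> T" "tautology (\<alpha> \<^bold>\<rightarrow> \<beta>)"
  shows "\<beta> \<in> T"
  using assms closed_theory_taut closed_theory_mp by metis

lemma closed_theory_taut2:
  assumes "closed_theory T" "\<alpha> \<in> T" "\<beta> \<in> T" "tautology (\<alpha> \<^bold>\<rightarrow> \<beta> \<^bold>\<rightarrow> \<gamma>)"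
  shows "\<gamma> \<in> T"
  using assms closed_theory_taut closed_theory_mp by metis

lemma closed_theory_Union_chain:
  assumes "C \<noteq> {}" "\<And>T. T \<in> C \<Longrightarrow> closed_theory T"
    and chain: "\<And>S T. S \<in> C \<Longrightarrow> T \<in> C \<Longrightarrow> S \<subseteq> T \<or> T \<subseteq> S"
  shows "closed_theory (\<Union>C)"
  unfolding closed_theory_def
proof (intro conjI allI impI)
  fix \<alpha> assume "tautology \<alpha>"
  then show "\<alpha> \<in> \<Union>C" using assms(1,2) closed_theory_taut by blast
next
  fix \<alpha> \<beta> assume "\<alpha> \<in> \<Union>C" "\<alpha> \<^bold>\<rightarrow> \<beta> \<in> \<Union>C"
  then obtain S T where "S \<in> C" "\<alpha> \<in> S" "T \<in> C" "\<alpha> \<^bold>\<rightarrow> \<beta> \<in> T" by blast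
  with chain[of S T] show "\<beta> \<in> \<Union>C"
    using assms(2) closed_theory_mp by blast
qed

text \<open>By the deduction theorem this set is the theory generated by \<open>T\<close> and
  \<open>\<alpha>\<close>.\<close>

lemma closed_theory_extend:
  assumes "closed_theory T"
  shows "closed_theory {\<beta>. \<alpha> \<^bold>\<rightarrow> \<beta> \<in> T}"
  unfolding closed_theory_def mem_Collect_eq
proof (intro conjI allI impI)
  fix \<beta> assume "tautology \<beta>"
  then show "\<alpha> \<^bold>\<rightarrow> \<beta> \<in> T" using assms by (auto intro!: closed_theory_taut simp: tautology_def)
next
  fix \<beta> \<gamma> assume "\<alpha> \<^bold>\<rightarrow> \<beta> \<in> T" "\<alpha> \<^bold>\<rightarrow> \<beta> \<^bold>\<rightarrow> \<gamma> \<in> T"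
  then show "\<alpha> \<^bold>\<rightarrow> \<gamma> \<in> T"
    by (rule closed_theory_taut2[OF assms]) (auto simp: tautology_def)
qed

text \<open>Lindenbaum's lemma: by Zorn, take a theory maximal among those omitting
  \<open>\<phi>\<close>; it is the truth set of a valuation.\<close>

lemma closed_theory_valuation:
  assumes "closed_theory T" "\<phi> \<notin> T"
  obtains w where "valuation w" "\<And>\<theta>. \<theta> \<in> T \<Longrightarrow> w \<theta>" "\<not> w \<phi>"
proof -
  define \<A> where "\<A> = {S. closed_theory S \<and> T \<subseteq> S \<and> \<phi> \<notin> S}"
  have "\<exists>M\<in>\<A>. \<forall>S\<in>\<A>. M \<subseteq> S \<longrightarrow> S = M"
  proof (rule subset_Zorn_nonempty)
    show "\<A> \<noteq> {}" using assms by (auto simp: \<A>_def)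
    fix C assume "C \<noteq> {}" "subset.chain \<A> C"
    then show "\<Union>C \<in> \<A>"
      using closed_theory_Union_chain[of C] by (auto simp: \<A>_def subset_chain_def)
  qed
  then obtain M where M: "closed_theory M" "T \<subseteq> M" "\<phi> \<notin> M"
    and max: "\<And>S. closed_theory S \<Longrightarrow> M \<subseteq> S \<Longrightarrow> \<phi> \<notin> S \<Longrightarrow> S = M"
    unfolding \<A>_def by auto
  note taut1 = closed_theory_taut1[OF M(1)] and taut2 = closed_theory_taut2[OF M(1)]
  \<comment> \<open>By maximality, adjoining \<open>\<alpha>\<close> must bring in
    \<open>\<phi>\<close>. Thus \<open>\<alpha> \<rightarrow> \<phi>\<close> plays the role of the
    negation of \<open>\<alpha>\<close>.\<close>
  have neg: "\<alpha> \<^bold>\<rightarrow> \<phi> \<in> M" if "\<alpha> \<notin> M" for \<alpha>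
  proof (rule ccontr)
    assume "\<alpha> \<^bold>\<rightarrow> \<phi> \<notin> M"
    moreover have "M \<subseteq> {\<beta>. \<alpha> \<^bold>\<rightarrow> \<beta> \<in> M}"
      using taut1[where \<beta> = "\<alpha> \<^bold>\<rightarrow> _"] by (auto simp: tautology_def)
    ultimately have "{\<beta>. \<alpha> \<^bold>\<rightarrow> \<beta> \<in> M} = M" using max closed_theory_extend[OF M(1)] by simp
    moreover have "\<alpha> \<^bold>\<rightarrow> \<alpha> \<in> M" by (auto intro: closed_theory_taut[OF M(1)] simp: tautology_def)
    ultimately show False using that by blast
  qed
  have bot: "\<^bold>\<bottom> \<notin> M" using M(3) taut1[of "\<^bold>\<bottom>" \<phi>] by (auto simp: tautology_def)
  have conj: "\<alpha> \<^bold>\<and> \<beta> \<in> M \<longleftrightarrow> \<alpha> \<in> M \<and> \<beta> \<in> M" for \<alpha> \<beta>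
    using taut1[of "\<alpha> \<^bold>\<and> \<beta>" \<alpha>] taut1[of "\<alpha> \<^bold>\<and> \<beta>" \<beta>] taut2[of \<alpha> \<beta> "\<alpha> \<^bold>\<and> \<beta>"]
    by (auto simp: tautology_def)
  have disj: "\<alpha> \<^bold>\<or> \<beta> \<in> M \<longleftrightarrow> \<alpha> \<in> M \<or> \<beta> \<in> M" for \<alpha> \<beta>
  proof
    assume "\<alpha> \<^bold>\<or> \<beta> \<in> M"
    show "\<alpha> \<in> M \<or> \<beta> \<in> M"
    proof (rule ccontr)
      assume "\<not> (\<alpha> \<in> M \<or> \<beta> \<in> M)"
      then have "\<alpha> \<^bold>\<rightarrow> \<phi> \<in> M" "\<beta> \<^bold>\<rightarrow> \<phi> \<in> M" using neg by auto
      then have "\<alpha> \<^bold>\<or> \<beta> \<^bold>\<rightarrow> \<phi> \<in> M" by (rule taut2) (auto simp: tautology_def)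
      then have "\<phi> \<in> M" using \<open>\<alpha> \<^bold>\<or> \<beta> \<in> M\<close> by (rule closed_theory_mp[OF M(1)])
      then show False using M(3) by contradiction
    qed
  next
    assume "\<alpha> \<in> M \<or> \<beta> \<in> M"
    then show "\<alpha> \<^bold>\<or> \<beta> \<in> M"
      using taut1[of \<alpha> "\<alpha> \<^bold>\<or> \<beta>"] taut1[of \<beta> "\<alpha> \<^bold>\<or> \<beta>"] by (auto simp: tautology_def)
  qed
  have imp: "\<alpha> \<^bold>\<rightarrow> \<beta> \<in> M \<longleftrightarrow> (\<alpha> \<in> M \<longrightarrow> \<beta> \<in> M)" for \<alpha> \<beta>
  proof
    assume "\<alpha> \<in> M \<longrightarrow> \<beta> \<in> M"
    then consider "\<beta> \<in> M" | "\<alpha> \<notin> M" by blast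
    then show "\<alpha> \<^bold>\<rightarrow> \<beta> \<in> M"
    proof cases
      case 1
      then show ?thesis by (rule taut1) (auto simp: tautology_def)
    next
      case 2
      show ?thesis
      proof (rule ccontr)
        assume "\<alpha> \<^bold>\<rightarrow> \<beta> \<notin> M"
        then have "\<alpha> \<^bold>\<rightarrow> \<phi> \<in> M" "(\<alpha> \<^bold>\<rightarrow> \<beta>) \<^bold>\<rightarrow> \<phi> \<in> M" using neg 2 by auto
        \<comment> \<open>Case distinction on \<open>\<alpha>\<close>: if it is false,
          \<open>\<alpha> \<rightarrow> \<beta>\<close> holds vacuously.\<close>
        then have "\<phi> \<in> M" by (rule taut2) (auto simp: tautology_def)
        then show False using M(3) by contradiction
      qed
    qed
  qed (use closed_theory_mp[OF M(1)] in blast)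
  have "eval (\<lambda>p. Var p \<in> M) (\<lambda>\<alpha>. \<^bold>\<box> \<alpha> \<in> M) \<alpha> \<longleftrightarrow> \<alpha> \<in> M" for \<alpha>
    by (induction \<alpha>) (simp_all add: bot conj disj imp)
  then have "valuation (\<lambda>\<alpha>. \<alpha> \<in> M)" by (rule valuationI)
  then show thesis
  proof (rule that)
    show "\<theta> \<in> M" if "\<theta> \<in> T" for \<theta> using M(2) that by (rule subsetD)
  qed (rule M(3))
qed

section \<open>Signed languages\<close>

text \<open>A language is a family indexed by signs, so that passing to an antecedent just swaps its
  two components.\<close>

definition over :: "(sign \<Rightarrow> propvar set) \<Rightarrow> fm \<Rightarrow> bool"
  where "over P \<phi> \<longleftrightarrow> (\<forall>s. signed_vars \<phi> s \<subseteq> P s)"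

lemma opposite_opposite [simp]: "opposite (opposite s) = s"
  by (cases s) auto

lemma all_opposite: "(\<forall>s. Q (opposite s)) \<longleftrightarrow> (\<forall>s. Q s)"
  by (metis opposite_opposite)

lemma over_simps [simp]:
  "over P \<^bold>\<bottom>"
  "over P (\<phi> \<^bold>\<and> \<psi>) \<longleftrightarrow> over P \<phi> \<and> over P \<psi>"
  "over P (\<phi> \<^bold>\<or> \<psi>) \<longleftrightarrow> over P \<phi> \<and> over P \<psi>"
  "over P (\<phi> \<^bold>\<rightarrow> \<psi>) \<longleftrightarrow> over (\<lambda>s. P (opposite s)) \<phi> \<and> over P \<psi>"
  "over P (\<^bold>\<box> \<phi>) \<longleftrightarrow> over P \<phi>"
  using all_opposite[of "\<lambda>s. signed_vars \<phi> s \<subseteq> P (opposite s)"]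
  by (auto simp: over_def)

lemma over_Boxes [simp]: "over P (Boxes k \<phi>) \<longleftrightarrow> over P \<phi>"
  by (induction k) auto

lemma over_signed_vars: "over (signed_vars \<phi>) \<phi>"
  by (simp add: over_def)

lemma over_Int: "over (\<lambda>s. P s \<inter> Q s) \<phi> \<longleftrightarrow> over P \<phi> \<and> over Q \<phi>"
  by (auto simp: over_def)

section \<open>Merging two valuations\<close>

text \<open>Intended instance: \<open>P\<close> and \<open>Q\<close> are the signed variables of
  \<open>\<phi>\<close> and \<open>\<psi>\<close>, \<open>w\<close> satisfies \<open>\<phi>\<close>
  and \<open>w'\<close> refutes \<open>\<psi>\<close>. The swapped \<open>P'\<close> and
  \<open>Q'\<close> describe the formulas whose negations are over \<open>P\<close> and
  \<open>Q\<close>.\<close>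

locale valuation_pair =
  fixes P Q :: "sign \<Rightarrow> propvar set" and w w' :: "fm \<Rightarrow> bool"
  assumes val: "valuation w" and val': "valuation w'"
    and common: "\<And>\<theta>. over P \<theta> \<Longrightarrow> over Q \<theta> \<Longrightarrow> w \<theta> \<Longrightarrow> w' \<theta>"
begin

abbreviation "P' \<equiv> \<lambda>s. P (opposite s)"
abbreviation "Q' \<equiv> \<lambda>s. Q (opposite s)"

lemma common': "over P' \<theta> \<Longrightarrow> over Q' \<theta> \<Longrightarrow> w' \<theta> \<Longrightarrow> w \<theta>"
  using common[of "\<^bold>\<not> \<theta>"] by (auto simp: valuation_simps[OF val] valuation_simps[OF val'])

text \<open>Merging asks for values above \<open>w\<close> on \<open>P\<close> and below
  \<open>w'\<close> on \<open>Q\<close>; the other two bounds are what these demand of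
  negations.\<close>

definition within :: "fm \<Rightarrow> bool \<Rightarrow> bool" where
  "within \<phi> x \<longleftrightarrow> (over P \<phi> \<longrightarrow> w \<phi> \<longrightarrow> x) \<and> (over Q' \<phi> \<longrightarrow> w' \<phi> \<longrightarrow> x) \<and>
     (over P' \<phi> \<longrightarrow> x \<longrightarrow> w \<phi>) \<and> (over Q \<phi> \<longrightarrow> x \<longrightarrow> w' \<phi>)"

text \<open>The admissible value nearest to \<open>x\<close>: the conjunction of the applicable
  upper bounds if \<open>x\<close> is true, the disjunction of the applicable lower bounds if it is
  false.\<close>

definition clamp :: "fm \<Rightarrow> bool \<Rightarrow> bool" where
  "clamp \<phi> x \<longleftrightarrow> (if x then (over P' \<phi> \<longrightarrow> w \<phi>) \<and> (over Q \<phi> \<longrightarrow> w' \<phi>)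
     else over P \<phi> \<and> w \<phi> \<or> over Q' \<phi> \<and> w' \<phi>)"

text \<open>No lower bound exceeds an upper one: \<open>w\<close> on \<open>P\<close> against
  \<open>w'\<close> on \<open>Q\<close> is \<open>common\<close>, \<open>w'\<close> on
  \<open>Q'\<close> against \<open>w\<close> on \<open>P'\<close> is \<open>common'\<close>, and the
  remaining two pairs compare a valuation with itself.\<close>

lemma within_clamp: "within \<phi> (clamp \<phi> x)"
  using common[of \<phi>] common'[of \<phi>] unfolding within_def clamp_def by auto

lemma clamp_within: "within \<phi> x \<Longrightarrow> clamp \<phi> x = x"
  unfolding within_def clamp_def by auto

text \<open>The value that the merged valuation takes at the formula without its outermost boxes.\<close>

primrec core_value :: "fm \<Rightarrow> bool" where
  "core_value (Var p) = clamp (Var p) False"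
| "core_value \<^bold>\<bottom> = False"
| "core_value (\<phi> \<^bold>\<and> \<psi>) = (clamp \<phi> (core_value \<phi>) \<and> clamp \<psi> (core_value \<psi>))"
| "core_value (\<phi> \<^bold>\<or> \<psi>) = (clamp \<phi> (core_value \<phi>) \<or> clamp \<psi> (core_value \<psi>))"
| "core_value (\<phi> \<^bold>\<rightarrow> \<psi>) = (clamp \<phi> (core_value \<phi>) \<longrightarrow> clamp \<psi> (core_value \<psi>))"
| "core_value (\<^bold>\<box> \<phi>) = core_value \<phi>"

text \<open>Only at boxed formulas can this clamp change the core value; elsewhere that value
  already respects the bounds. The starting value \<open>False\<close> of variables is an arbitrary
  choice.\<close>

definition merged :: "fm \<Rightarrow> bool"
  where "merged \<phi> = clamp \<phi> (core_value \<phi>)"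

lemma core_value_Boxes [simp]: "core_value (Boxes k \<phi>) = core_value \<phi>"
  by (induction k) auto

lemma within_merged: "within \<phi> (merged \<phi>)"
  by (simp add: merged_def within_clamp)

text \<open>The bounds are compositional: a compound in a language has its parts there too,
  antecedents in the swapped language, and \<open>w\<close> and \<open>w'\<close> respect the
  connectives. Combining admissible values is therefore admissible, and clamping leaves the result
  unchanged.\<close>

lemma merged_connectives:
  "\<not> merged \<^bold>\<bottom>"
  "merged (\<phi> \<^bold>\<and> \<psi>) \<longleftrightarrow> merged \<phi> \<and> merged \<psi>"
  "merged (\<phi> \<^bold>\<or> \<psi>) \<longleftrightarrow> merged \<phi> \<or> merged \<psi>"
  "merged (\<phi> \<^bold>\<rightarrow> \<psi>) \<longleftrightarrow> (merged \<phi> \<longrightarrow> merged \<psi>)"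
proof -
  note vals = valuation_simps[OF val] valuation_simps[OF val']
  note bounds = within_merged[of \<phi>, unfolded within_def] within_merged[of \<psi>, unfolded within_def]
  have "within \<^bold>\<bottom> False" by (simp add: within_def vals)
  from clamp_within[OF this] show "\<not> merged \<^bold>\<bottom>" by (simp add: merged_def)
  have "within (\<phi> \<^bold>\<and> \<psi>) (merged \<phi> \<and> merged \<psi>)"
    using bounds by (auto simp: within_def vals)
  from clamp_within[OF this] show "merged (\<phi> \<^bold>\<and> \<psi>) \<longleftrightarrow> merged \<phi> \<and> merged \<psi>"
    by (simp add: merged_def)
  have "within (\<phi> \<^bold>\<or> \<psi>) (merged \<phi> \<or> merged \<psi>)"
    using bounds by (auto simp: within_def vals)
  from clamp_within[OF this] show "merged (\<phi> \<^bold>\<or> \<psi>) \<longleftrightarrow> merged \<phi> \<or> merged \<psi>"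
    by (simp add: merged_def)
  have "within (\<phi> \<^bold>\<rightarrow> \<psi>) (merged \<phi> \<longrightarrow> merged \<psi>)"
    using bounds by (auto simp: within_def vals)
  from clamp_within[OF this] show "merged (\<phi> \<^bold>\<rightarrow> \<psi>) \<longleftrightarrow> (merged \<phi> \<longrightarrow> merged \<psi>)"
    by (simp add: merged_def)
qed

lemma valuation_merged: "valuation merged"
proof -
  have "eval (\<lambda>p. merged (Var p)) (\<lambda>\<alpha>. merged (\<^bold>\<box> \<alpha>)) \<phi> = merged \<phi>" for \<phi>
    by (induction \<phi>) (simp_all add: merged_connectives)
  then show ?thesis by (rule valuationI)
qed

text \<open>Induction on derivations. \<open>w\<close> and \<open>w'\<close> need not be closed
  under Nec or the rules, but they verify each conclusion because it is itself a theorem.\<close>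

lemma merged_sound:
  assumes Ax: "\<And>\<alpha>. \<alpha> \<in> Ax \<Longrightarrow> \<exists>n m \<rho>. \<alpha> = Boxes n \<rho> \<^bold>\<rightarrow> Boxes m \<rho>"
    and R: "\<And>\<alpha> \<beta>. (\<alpha>, \<beta>) \<in> R \<Longrightarrow> \<exists>i j \<rho>. \<alpha> = \<^bold>\<not> Boxes i \<rho> \<and> \<beta> = \<^bold>\<not> Boxes j \<rho>"
    and w: "\<And>\<alpha>. \<alpha> \<in> N_ext Ax R \<Longrightarrow> w \<alpha>" and w': "\<And>\<alpha>. \<alpha> \<in> N_ext Ax R \<Longrightarrow> w' \<alpha>"
    and "\<phi> \<in> N_ext Ax R"
  shows "merged \<phi>"
  using \<open>\<phi> \<in> N_ext Ax R\<close>
proof (induction rule: N_ext.induct)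
  case (Taut \<phi>)
  then show ?case using valuation_merged by (auto simp: valuation_def tautology_def)
next
  case (Axiom \<phi>)
  then obtain n m \<rho> where \<phi>: "\<phi> = Boxes n \<rho> \<^bold>\<rightarrow> Boxes m \<rho>" using Ax by blast
  have "w \<phi>" "w' \<phi>" using w w' N_ext.Axiom[OF Axiom] by auto
  then show ?case
    \<comment> \<open>Both sides have the same core value and the same applicable bounds, so their
      values are the same monotone combination of \<open>w\<close> and \<open>w'\<close>.\<close>
    by (auto simp: \<phi> merged_connectives merged_def clamp_def
        valuation_simps[OF val] valuation_simps[OF val'] split: if_splits)
next
  case (MP \<phi> \<psi>)
  then show ?case by (simp add: merged_connectives)
next
  case (Nec \<phi>)
  have "w (\<^bold>\<box> \<phi>)" "w' (\<^bold>\<box> \<phi>)" using w w' N_ext.Nec[OF Nec.hyps] by auto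
  \<comment> \<open>With a true core value this is a conjunction of truths. With a false one, the
    induction hypothesis shows that some lower bound applies, and at the boxed formula it is
    true.\<close>
  then show ?case using Nec.IH by (auto simp: merged_def clamp_def split: if_splits)
next
  case (Rule \<phi> \<psi>)
  then obtain i j \<rho> where \<phi>: "\<phi> = \<^bold>\<not> Boxes i \<rho>" and \<psi>: "\<psi> = \<^bold>\<not> Boxes j \<rho>" using R by blast
  have "w \<psi>" "w' \<psi>" using w w' N_ext.Rule[OF Rule.hyps] by auto
  \<comment> \<open>Dual to Nec: a false core value gives a disjunction of falsehoods; for a true
    one, the induction hypothesis yields an applicable upper bound, now false.\<close>
  then show ?case using Rule.IH
    by (auto simp: \<phi> \<psi> merged_connectives merged_def clamp_def
        valuation_simps[OF val] valuation_simps[OF val'] split: if_splits)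
qed

end

section \<open>Interpolation\<close>

lemma closed_theory_N_ext: "closed_theory (N_ext Ax R)"
  unfolding closed_theory_def by (blast intro: N_ext.Taut N_ext.MP)

text \<open>First \<open>w'\<close> is chosen to refute \<open>\<psi>\<close> and satisfy every
  consequence of \<open>\<phi>\<close> in \<open>\<Theta>\<close>, then \<open>w\<close> to satisfy
  \<open>\<phi>\<close> and refute whatever \<open>w'\<close> refutes in \<open>\<Theta>\<close>.
  Only conjunction and disjunction are assumed on \<open>\<Theta>\<close>, since a signed language
  is not closed under negation.\<close>

lemma no_interpolant_valuations:
  assumes L: "closed_theory L"
    and bot: "\<^bold>\<bottom> \<in> \<Theta>" and top: "\<^bold>\<not> \<^bold>\<bottom> \<in> \<Theta>"
    and conj: "\<And>\<theta> \<eta>. \<theta> \<in> \<Theta> \<Longrightarrow> \<eta> \<in> \<Theta> \<Longrightarrow> \<theta> \<^bold>\<and> \<eta> \<in> \<Theta>"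
    and disj: "\<And>\<theta> \<eta>. \<theta> \<in> \<Theta> \<Longrightarrow> \<eta> \<in> \<Theta> \<Longrightarrow> \<theta> \<^bold>\<or> \<eta> \<in> \<Theta>"
    and none: "\<not> (\<exists>\<chi>\<in>\<Theta>. \<phi> \<^bold>\<rightarrow> \<chi> \<in> L \<and> \<chi> \<^bold>\<rightarrow> \<psi> \<in> L)"
  obtains w w' where "valuation w" "valuation w'" "\<And>\<theta>. \<theta> \<in> L \<Longrightarrow> w \<theta>" "\<And>\<theta>. \<theta> \<in> L \<Longrightarrow> w' \<theta>"
    "w \<phi>" "\<not> w' \<psi>" "\<And>\<theta>. \<theta> \<in> \<Theta> \<Longrightarrow> w \<theta> \<Longrightarrow> w' \<theta>"
proof -
  note taut = closed_theory_taut[OF L] and taut1 = closed_theory_taut1[OF L]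
    and taut2 = closed_theory_taut2[OF L]
  \<comment> \<open>A witness placing \<open>\<psi>\<close> in this theory would be an
    interpolant.\<close>
  define T' where "T' = {\<beta>. \<exists>\<theta>\<in>\<Theta>. \<phi> \<^bold>\<rightarrow> \<theta> \<in> L \<and> \<theta> \<^bold>\<rightarrow> \<beta> \<in> L}"
  have L': "L \<subseteq> T'"
  proof
    fix \<beta> assume "\<beta> \<in> L"
    then have "\<^bold>\<not> \<^bold>\<bottom> \<^bold>\<rightarrow> \<beta> \<in> L" by (rule taut1) (auto simp: tautology_def)
    moreover have "\<phi> \<^bold>\<rightarrow> \<^bold>\<not> \<^bold>\<bottom> \<in> L" by (rule taut) (auto simp: tautology_def)
    ultimately show "\<beta> \<in> T'" using top by (auto simp: T'_def)
  qed
  have "closed_theory T'"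
    unfolding closed_theory_def
  proof (intro conjI allI impI)
    fix \<alpha> \<beta> assume "\<alpha> \<in> T'" "\<alpha> \<^bold>\<rightarrow> \<beta> \<in> T'"
    then obtain \<theta> \<eta> where \<Theta>: "\<theta> \<in> \<Theta>" "\<eta> \<in> \<Theta>"
      and 1: "\<phi> \<^bold>\<rightarrow> \<theta> \<in> L" "\<phi> \<^bold>\<rightarrow> \<eta> \<in> L" and 2: "\<theta> \<^bold>\<rightarrow> \<alpha> \<in> L" "\<eta> \<^bold>\<rightarrow> \<alpha> \<^bold>\<rightarrow> \<beta> \<in> L"
      by (auto simp: T'_def)
    have "\<phi> \<^bold>\<rightarrow> \<theta> \<^bold>\<and> \<eta> \<in> L" using 1 by (rule taut2) (auto simp: tautology_def)
    moreover have "\<theta> \<^bold>\<and> \<eta> \<^bold>\<rightarrow> \<beta> \<in> L" using 2 by (rule taut2) (auto simp: tautology_def)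
    ultimately show "\<beta> \<in> T'" using conj[OF \<Theta>] by (auto simp: T'_def)
  qed (use L' taut in blast)
  moreover have "\<psi> \<notin> T'" using none by (auto simp: T'_def)
  ultimately obtain w' where w': "valuation w'" "\<And>\<theta>. \<theta> \<in> T' \<Longrightarrow> w' \<theta>" "\<not> w' \<psi>"
    using closed_theory_valuation by blast
  note vals = valuation_simps[OF w'(1)]
  \<comment> \<open>The theory generated by \<open>L\<close>, \<open>\<phi>\<close> and the
    negations of the members of \<open>\<Theta>\<close> false at \<open>w'\<close>. Writing
    \<open>\<theta> \<or> \<beta>\<close> lets a disjunction in \<open>\<Theta>\<close> collect
    several such negated assumptions.\<close>
  define T where "T = {\<beta>. \<exists>\<theta>\<in>\<Theta>. \<not> w' \<theta> \<and> \<phi> \<^bold>\<rightarrow> \<theta> \<^bold>\<or> \<beta> \<in> L}"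
  have T_bot: "\<beta> \<in> T" if "\<phi> \<^bold>\<rightarrow> \<^bold>\<bottom> \<^bold>\<or> \<beta> \<in> L" for \<beta>
    using that bot vals(1) by (auto simp: T_def)
  have LT: "L \<subseteq> T"
  proof
    fix \<beta> assume "\<beta> \<in> L"
    then have "\<phi> \<^bold>\<rightarrow> \<^bold>\<bottom> \<^bold>\<or> \<beta> \<in> L" by (rule taut1) (auto simp: tautology_def)
    then show "\<beta> \<in> T" by (rule T_bot)
  qed
  have "closed_theory T"
    unfolding closed_theory_def
  proof (intro conjI allI impI)
    fix \<alpha> \<beta> assume "\<alpha> \<in> T" "\<alpha> \<^bold>\<rightarrow> \<beta> \<in> T"
    then obtain \<theta> \<eta> where \<Theta>: "\<theta> \<in> \<Theta>" "\<eta> \<in> \<Theta>" "\<not> w' \<theta>" "\<not> w' \<eta>"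
      and 1: "\<phi> \<^bold>\<rightarrow> \<theta> \<^bold>\<or> \<alpha> \<in> L" "\<phi> \<^bold>\<rightarrow> \<eta> \<^bold>\<or> (\<alpha> \<^bold>\<rightarrow> \<beta>) \<in> L"
      by (auto simp: T_def)
    have "\<phi> \<^bold>\<rightarrow> (\<theta> \<^bold>\<or> \<eta>) \<^bold>\<or> \<beta> \<in> L" using 1 by (rule taut2) (auto simp: tautology_def)
    then show "\<beta> \<in> T" using disj[OF \<Theta>(1,2)] \<Theta>(3,4) vals(3) by (auto simp: T_def)
  qed (use LT taut in blast)
  \<comment> \<open>Inconsistency would make some \<open>\<theta>\<close> false at \<open>w'\<close>
    a consequence of \<open>\<phi>\<close>, but \<open>w'\<close> satisfies those.\<close>
  moreover have "\<^bold>\<bottom> \<notin> T"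
  proof
    assume "\<^bold>\<bottom> \<in> T"
    then obtain \<theta> where \<theta>: "\<theta> \<in> \<Theta>" "\<not> w' \<theta>" "\<phi> \<^bold>\<rightarrow> \<theta> \<^bold>\<or> \<^bold>\<bottom> \<in> L" by (auto simp: T_def)
    have "\<phi> \<^bold>\<rightarrow> \<theta> \<in> L" using \<theta>(3) by (rule taut1) (auto simp: tautology_def)
    moreover have "\<theta> \<^bold>\<rightarrow> \<theta> \<in> L" by (rule taut) (auto simp: tautology_def)
    ultimately have "\<theta> \<in> T'" using \<theta>(1) by (auto simp: T'_def)
    then show False using w'(2) \<theta>(2) by blast
  qed
  ultimately obtain w where w: "valuation w" "\<And>\<theta>. \<theta> \<in> T \<Longrightarrow> w \<theta>"
    using closed_theory_valuation by blast
  have "\<phi> \<in> T" by (intro T_bot taut) (auto simp: tautology_def)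
  moreover have "w' \<theta>" if "\<theta> \<in> \<Theta>" "w \<theta>" for \<theta>
  proof (rule ccontr)
    assume "\<not> w' \<theta>"
    moreover have "\<phi> \<^bold>\<rightarrow> \<theta> \<^bold>\<or> \<^bold>\<not> \<theta> \<in> L" by (rule taut) (auto simp: tautology_def)
    ultimately have "\<^bold>\<not> \<theta> \<in> T" using that(1) by (auto simp: T_def)
    then show False using w(2) that(2) valuation_simps[OF w(1)] by blast
  qed
  ultimately show thesis
    using that[of w w'] w w' LT L' by blast
qed

text \<open>Stated by the shape of axioms and rules alone, so that one argument covers all three
  logics.\<close>

theorem LIP_N_ext:
  assumes Ax: "\<And>\<alpha>. \<alpha> \<in> Ax \<Longrightarrow> \<exists>n m \<rho>. \<alpha> = Boxes n \<rho> \<^bold>\<rightarrow> Boxes m \<rho>"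
    and R: "\<And>\<alpha> \<beta>. (\<alpha>, \<beta>) \<in> R \<Longrightarrow> \<exists>i j \<rho>. \<alpha> = \<^bold>\<not> Boxes i \<rho> \<and> \<beta> = \<^bold>\<not> Boxes j \<rho>"
  shows "LIP (N_ext Ax R)"
  unfolding LIP_def
proof (intro allI impI)
  fix \<phi> \<psi> assume \<phi>\<psi>: "\<phi> \<^bold>\<rightarrow> \<psi> \<in> N_ext Ax R"
  define \<Theta> where "\<Theta> = {\<theta>. over (\<lambda>s. signed_vars \<phi> s \<inter> signed_vars \<psi> s) \<theta>}"
  have "\<exists>\<chi>\<in>\<Theta>. \<phi> \<^bold>\<rightarrow> \<chi> \<in> N_ext Ax R \<and> \<chi> \<^bold>\<rightarrow> \<psi> \<in> N_ext Ax R"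
  proof (rule ccontr)
    assume none: "\<not> ?thesis"
    obtain w w' where w: "valuation w" "valuation w'"
      "\<And>\<theta>. \<theta> \<in> N_ext Ax R \<Longrightarrow> w \<theta>" "\<And>\<theta>. \<theta> \<in> N_ext Ax R \<Longrightarrow> w' \<theta>"
      "w \<phi>" "\<not> w' \<psi>" and common: "\<And>\<theta>. \<theta> \<in> \<Theta> \<Longrightarrow> w \<theta> \<Longrightarrow> w' \<theta>"
      by (rule no_interpolant_valuations[OF closed_theory_N_ext _ _ _ _ none]) (auto simp: \<Theta>_def)
    interpret valuation_pair "signed_vars \<phi>" "signed_vars \<psi>" w w'
      using w common by unfold_locales (auto simp: \<Theta>_def over_Int)
    \<comment> \<open>\<open>w\<close> bounds \<open>\<phi>\<close> from below by truth,
      \<open>w'\<close> bounds \<open>\<psi>\<close> from above by falsity.\<close>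
    have "merged \<phi>" "\<not> merged \<psi>"
      using within_merged[of \<phi>] within_merged[of \<psi>] w(5,6) over_signed_vars
      by (auto simp: within_def)
    moreover have "merged (\<phi> \<^bold>\<rightarrow> \<psi>)" using Ax R w(3,4) \<phi>\<psi> by (rule merged_sound)
    ultimately show False by (simp add: merged_connectives)
  qed
  then show "\<exists>\<chi>. (\<forall>s. signed_vars \<chi> s \<subseteq> signed_vars \<phi> s \<inter> signed_vars \<psi> s) \<and>
      \<phi> \<^bold>\<rightarrow> \<chi> \<in> N_ext Ax R \<and> \<chi> \<^bold>\<rightarrow> \<psi> \<in> N_ext Ax R"
    by (auto simp: \<Theta>_def over_def)
qed

lemma LIP_imp_CIP:
  assumes "LIP L"
  shows "CIP L"
  unfolding CIP_def
proof (intro allI impI)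
  fix \<phi> \<psi> assume "\<phi> \<^bold>\<rightarrow> \<psi> \<in> L"
  with assms obtain \<chi> where "\<And>s. signed_vars \<chi> s \<subseteq> signed_vars \<phi> s \<inter> signed_vars \<psi> s"
    and "\<phi> \<^bold>\<rightarrow> \<chi> \<in> L" "\<chi> \<^bold>\<rightarrow> \<psi> \<in> L"
    unfolding LIP_def by blast
  then show "\<exists>\<chi>. vars \<chi> \<subseteq> vars \<phi> \<inter> vars \<psi> \<and> \<phi> \<^bold>\<rightarrow> \<chi> \<in> L \<and> \<chi> \<^bold>\<rightarrow> \<psi> \<in> L"
    unfolding vars_def by (intro exI[of _ \<chi>]) blast
qed

theorem corollary3p7:
  fixes m n :: nat and L :: "fm set"
  assumes "L = NA m n \<or> L = NplusA m n \<or> L = NRA m n"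
  shows "LIP L \<and> CIP L"
proof -
  have Acc: "\<alpha> \<in> Acc m n \<Longrightarrow> \<exists>n m \<rho>. \<alpha> = Boxes n \<rho> \<^bold>\<rightarrow> Boxes m \<rho>" for \<alpha>
    by (auto simp: Acc_def)
  have "LIP (NA m n)"
    unfolding NA_def by (rule LIP_N_ext) (auto intro: Acc)
  moreover have "LIP (NplusA m n)"
    unfolding NplusA_def
  proof (rule LIP_N_ext)
    fix \<alpha> \<beta> assume "(\<alpha>, \<beta>) \<in> {(\<^bold>\<not> \<^bold>\<box> \<phi>, \<^bold>\<not> \<^bold>\<box> \<^bold>\<box> \<phi>) | \<phi>. True}"
    then obtain \<rho> where "\<alpha> = \<^bold>\<not> Boxes 1 \<rho>" "\<beta> = \<^bold>\<not> Boxes 2 \<rho>"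
      by (auto simp: numeral_2_eq_2)
    then show "\<exists>i j \<rho>. \<alpha> = \<^bold>\<not> Boxes i \<rho> \<and> \<beta> = \<^bold>\<not> Boxes j \<rho>" by blast
  qed (rule Acc)
  moreover have "LIP (NRA m n)"
    unfolding NRA_def
  proof (rule LIP_N_ext)
    fix \<alpha> \<beta> assume "(\<alpha>, \<beta>) \<in> {(\<^bold>\<not> \<phi>, \<^bold>\<not> \<^bold>\<box> \<phi>) | \<phi>. True}"
    \<comment> \<open>Zero boxes in the premise let it negate an arbitrary formula.\<close>
    then obtain \<rho> where "\<alpha> = \<^bold>\<not> Boxes 0 \<rho>" "\<beta> = \<^bold>\<not> Boxes 1 \<rho>"
      by auto
    then show "\<exists>i j \<rho>. \<alpha> = \<^bold>\<not> Boxes i \<rho> \<and> \<beta> = \<^bold>\<not> Boxes j \<rho>" by blast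
  qed (rule Acc)
  ultimately have "LIP L" using assms by auto
  then show ?thesis using LIP_imp_CIP by blast
qed

end
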